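(* Let $m,n,s\ge 1$ be integers, $N=mn$, let $K_i\in\mathbb{R}^{n\times n}$ and $H_i\in\mathbb{R}^{m\times m}$ for $i=1,\dots,s$, let $A_s=\sum_{i=1}^s K_i\otimes H_i\in\mathbb{R}^{N\times N}$, let $B\in\mathbb{R}^{m\times n}$, $b=\mathrm{vec}(B)\in\mathbb{R}^N$, and let $\lambda>0$. Let $L>0$ be a Lipschitz constant of the gradient of $x\mapsto\frac12\|A_sx-b\|_2^2$. Let $\{X_k\}$, $\{Y_k\}$ be the sequences generated by sFISTA applied to $$\min_{X\in\mathbb{R}^{m\times n}}\ \frac12\Big\|\sum_{i=1}^sH_iXK_i^T-B\Big\|_F^2+\frac{\lambda^2}{2}\|X\|_F^2$$ with constant $L$ and initial point $X_0\in\mathbb{R}^{m\times n}$, and let $\{x_k\}$, $\{y_k\}$ be the sequences generated by FISTA applied to $$\min_{x\in\mathbb{R}^N}\ \frac12\|A_sx-b\|_2^2+\frac{\lambda^2}{2}\|x\|_2^2$$ with the same constant $L$ and initial point $x_0\in\mathbb{R}^N$. If $x_0=\mathrm{vec}(X_0)$, then $x_k=\mathrm{vec}(X_k)$ and $y_k=\mathrm{vec}(Y_k)$ for all $k\ge 1$; that is, the two algorithms provide the same output.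
   Context: $\mathrm{vec}(X)$ denotes the column vector obtained by stacking the columns of the matrix $X$ one after the other. The Kronecker product $K\otimes H$ of $K\in\mathbb{R}^{n\times n}$ and $H\in\mathbb{R}^{m\times m}$ is the $mn\times mn$ block matrix whose $(i,j)$ block is $k_{ij}H$. $\|\cdot\|_F$ is the Frobenius norm. Both algorithms use the scalars $t_1=1$, $t_{k+1}=\frac{1+\sqrt{1+4t_k^2}}{2}$. FISTA (for the vector problem with matrix $A_s$, constant $L$): set $y_1=x_0$, and for $k=1,2,\dots$ $$x_k=\frac{1}{L+\lambda^2}\big(Ly_k-A_s^T(A_sy_k-b)\big),\qquad y_{k+1}=x_k+\frac{t_k-1}{t_{k+1}}(x_k-x_{k-1}).$$ sFISTA (for the matrix problem, constant $L$): set $Y_1=X_0$, and for $k=1,2,\dots$ $$X_k=\frac{1}{L+\lambda^2}\Big(LY_k-\sum_{j=1}^sH_j^T\Big(\sum_{i=1}^sH_iY_kK_i^T-B\Big)K_j\Big),\qquad Y_{k+1}=X_k+\frac{t_k-1}{t_{k+1}}(X_k-X_{k-1}).$$ The output of sFISTA after $k$ iterations is $\mathrm{vec}(X_k)$, and that of FISTA is $x_k$. *)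

theory Defs
  imports Complex_Main "Jordan_Normal_Form.Matrix"
begin

text \<open>Vectors and matrices are those of \<open>Jordan_Normal_Form\<close>; their row and column
  indices start at 0. Indices of iterations and of the terms of the sums start at 1.\<close>

text \<open>The column-stacking operator: with \<open>m\<close> rows, entry \<open>j * m + i\<close> of the result is the
  entry in row \<open>i\<close> and column \<open>j\<close>, see \<open>vectorize_index\<close>. (The name \<open>vec\<close> is taken by the
  library.)\<close>

definition vectorize :: "'a mat \<Rightarrow> 'a vec" where
  "vectorize X = vec (dim_row X * dim_col X) (\<lambda>k. X $$ (k mod dim_row X, k div dim_row X))"

text \<open>Block \<open>(i, j)\<close> of the Kronecker product is \<open>K $$ (i, j)\<close> times \<open>H\<close>, see
  \<open>kronecker_index\<close>.\<close>

definition kronecker :: "'a::times mat \<Rightarrow> 'a mat \<Rightarrow> 'a mat" where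
  "kronecker K H = mat (dim_row K * dim_row H) (dim_col K * dim_col H)
     (\<lambda>(r, c). K $$ (r div dim_row H, c div dim_col H) * H $$ (r mod dim_row H, c mod dim_col H))"

lemma block_index_less:
  fixes i m n p :: nat
  assumes "i < n" "p < m"
  shows "i * m + p < n * m"
proof -
  have "i * m + p < Suc i * m" using assms(2) by simp
  also have "\<dots> \<le> n * m" using assms(1) by (intro mult_le_mono1) simp
  finally show ?thesis .
qed

lemma vectorize_index:
  assumes "X \<in> carrier_mat m n" "i < m" "j < n"
  shows "vectorize X $ (j * m + i) = X $$ (i, j)"
  using assms block_index_less[of j n i m] by (simp add: vectorize_def mult.commute)

lemma kronecker_index:
  assumes "K \<in> carrier_mat n n'" "H \<in> carrier_mat m m'" "i < n" "j < n'" "p < m" "q < m'"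
  shows "kronecker K H $$ (i * m + p, j * m' + q) = K $$ (i, j) * H $$ (p, q)"
  using assms block_index_less[of i n p m] block_index_less[of j n' q m']
  by (simp add: kronecker_def)

text \<open>\<open>mat\<close> is not an instance of \<open>comm_monoid_add\<close> (the zero matrix depends on the
  dimensions), so sums of matrices are taken in the module of \<open>nr \<times> nc\<close> matrices.\<close>

abbreviation mat_sum :: "nat \<Rightarrow> nat \<Rightarrow> ('i \<Rightarrow> real mat) \<Rightarrow> 'i set \<Rightarrow> real mat" where
  "mat_sum nr nc \<equiv> finsum (module_mat TYPE(real) nr nc)"

definition norm2 :: "real vec \<Rightarrow> real" where
  "norm2 v = sqrt (v \<bullet> v)"

text \<open>The type \<open>real vec\<close> contains vectors of all dimensions and is not a normed space,
  hence the Frechet gradient is written out on \<open>carrier_vec N\<close>.\<close>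

definition has_gradient :: "nat \<Rightarrow> (real vec \<Rightarrow> real) \<Rightarrow> real vec \<Rightarrow> real vec \<Rightarrow> bool" where
  "has_gradient N f g x \<longleftrightarrow> x \<in> carrier_vec N \<and> g \<in> carrier_vec N \<and>
     (\<forall>\<epsilon>>0. \<exists>\<delta>>0. \<forall>z\<in>carrier_vec N. norm2 (z - x) < \<delta> \<longrightarrow>
        \<bar>f z - f x - g \<bullet> (z - x)\<bar> \<le> \<epsilon> * norm2 (z - x))"

definition gradient_lipschitz :: "nat \<Rightarrow> (real vec \<Rightarrow> real) \<Rightarrow> real \<Rightarrow> bool" where
  "gradient_lipschitz N f L \<longleftrightarrow> (\<exists>grad. (\<forall>x\<in>carrier_vec N. has_gradient N f (grad x) x) \<and>
     (\<forall>x\<in>carrier_vec N. \<forall>z\<in>carrier_vec N. norm2 (grad x - grad z) \<le> L * norm2 (x - z)))"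

text \<open>The value at 0 is a dummy: the scalars are indexed from 1.\<close>

fun fista_t :: "nat \<Rightarrow> real" where
  "fista_t 0 = 1"
| "fista_t (Suc 0) = 1"
| "fista_t (Suc (Suc k)) = (1 + sqrt (1 + 4 * (fista_t (Suc k))\<^sup>2)) / 2"

text \<open>The sequences \<open>x\<close>, \<open>y\<close> generated by FISTA from \<open>x0\<close>, and likewise \<open>X\<close>, \<open>Y\<close> for sFISTA.
  The values \<open>y 0\<close> and \<open>Y 0\<close> are not part of the algorithms and are left unconstrained.\<close>

definition FISTA :: "real mat \<Rightarrow> real vec \<Rightarrow> real \<Rightarrow> real \<Rightarrow> real vec \<Rightarrow>
    (nat \<Rightarrow> real vec) \<Rightarrow> (nat \<Rightarrow> real vec) \<Rightarrow> bool" where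
  "FISTA A b lam L x0 x y \<longleftrightarrow> x 0 = x0 \<and> y 1 = x0 \<and>
     (\<forall>k\<ge>1.
        x k = (1 / (L + lam\<^sup>2)) \<cdot>\<^sub>v
          (L \<cdot>\<^sub>v y k - transpose_mat A *\<^sub>v (A *\<^sub>v y k - b)) \<and>
        y (k + 1) = x k + ((fista_t k - 1) / fista_t (k + 1)) \<cdot>\<^sub>v (x k - x (k - 1)))"

definition sFISTA :: "nat \<Rightarrow> nat \<Rightarrow> nat \<Rightarrow> (nat \<Rightarrow> real mat) \<Rightarrow> (nat \<Rightarrow> real mat) \<Rightarrow> real mat \<Rightarrow>
    real \<Rightarrow> real \<Rightarrow> real mat \<Rightarrow> (nat \<Rightarrow> real mat) \<Rightarrow> (nat \<Rightarrow> real mat) \<Rightarrow> bool" where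
  "sFISTA m n s K H B lam L X0 X Y \<longleftrightarrow> X 0 = X0 \<and> Y 1 = X0 \<and>
     (\<forall>k\<ge>1.
        X k = (1 / (L + lam\<^sup>2)) \<cdot>\<^sub>m
          (L \<cdot>\<^sub>m Y k -
           mat_sum m n (\<lambda>j. transpose_mat (H j) *
             (mat_sum m n (\<lambda>i. H i * Y k * transpose_mat (K i)) {1..s} - B) * K j) {1..s}) \<and>
        Y (k + 1) = X k + ((fista_t k - 1) / fista_t (k + 1)) \<cdot>\<^sub>m (X k - X (k - 1)))"

end

theory Submission
  imports Defs
begin

text \<open>Vectorization is linear and turns the map \<open>X \<mapsto> H * X * K\<^sup>T\<close> into multiplication by
  the Kronecker product of \<open>K\<close> and \<open>H\<close> (\<open>kronecker_mult_vectorize\<close>). Summing over the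
  terms, \<open>A\<^sub>s\<close> represents \<open>X \<mapsto> \<Sum>i. H\<^sub>i * X * K\<^sub>i\<^sup>T\<close>
  (\<open>kronecker_sum_mult_vectorize\<close>). The transpose of a Kronecker product is the Kronecker
  product of the transposes, so the same identity, applied to the transposed factors, shows
  that the transpose of \<open>A\<^sub>s\<close> represents \<open>X \<mapsto> \<Sum>j. H\<^sub>j\<^sup>T * X * K\<^sub>j\<close>.

  Hence a gradient step of sFISTA vectorizes to a gradient step of FISTA
  (\<open>vectorize_gradient_step\<close>), and a momentum step does so by linearity alone: its coefficient
  depends only on \<open>k\<close>. Because the momentum step reaches back to the previous iterate, the
  induction on \<open>k\<close> carries the claim for \<open>Y k\<close> together with the one for \<open>X (k - 1)\<close>.\<close>

section \<open>Vectorization is linear\<close>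

lemma vectorize_carrier [simp]:
  "X \<in> carrier_mat m n \<Longrightarrow> vectorize X \<in> carrier_vec (m * n)"
  by (auto simp: vectorize_def)

lemma column_index_less: "k < m * n \<Longrightarrow> k div m < n" for k m n :: nat
  by (simp add: less_mult_imp_div_less mult.commute)

lemma row_index_less: "k < m * n \<Longrightarrow> k mod m < m" for k m n :: nat
  by (cases "m = 0") auto

lemma vectorize_add:
  assumes "X \<in> carrier_mat m n" "Z \<in> carrier_mat m n"
  shows "vectorize (X + Z) = vectorize X + vectorize Z"
  using assms by (auto simp: vectorize_def row_index_less column_index_less)

lemma vectorize_minus:
  assumes "X \<in> carrier_mat m n" "Z \<in> carrier_mat m n"
  shows "vectorize (X - Z) = vectorize X - vectorize Z"
  using assms by (auto simp: vectorize_def row_index_less column_index_less)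

lemma vectorize_smult: "vectorize (c \<cdot>\<^sub>m X) = c \<cdot>\<^sub>v vectorize X"
  by (auto simp: vectorize_def row_index_less column_index_less)

section \<open>Sums of matrices\<close>

lemma abelian_monoid_module_mat:
  "abelian_monoid (module_mat TYPE('a::comm_ring_1) nr nc)"
  using abelian_group_mat[of nr nc] unfolding abelian_group_def by blast

lemma carrier_module_mat: "carrier (module_mat TYPE('a::comm_ring_1) nr nc) = carrier_mat nr nc"
  by (simp add: module_mat_simps)

text \<open>A finite sum in a commutative monoid given by a carrier unfolds only when its terms
  lie in that carrier; hence the dimension hypotheses on the terms below.\<close>

lemma mat_sum_carrier:
  assumes "\<And>i. i \<in> I \<Longrightarrow> F i \<in> carrier_mat nr nc"
  shows "mat_sum nr nc F I \<in> carrier_mat nr nc"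
  using abelian_monoid.finsum_closed[OF abelian_monoid_module_mat, of F I nr nc] assms
  by (auto simp: carrier_module_mat)

lemma mat_sum_empty: "mat_sum nr nc F {} = 0\<^sub>m nr nc"
  using abelian_monoid.finsum_empty[OF abelian_monoid_module_mat[where 'a=real], of nr nc]
  by (simp add: module_mat_simps)

lemma mat_sum_insert:
  assumes "finite I" "i \<notin> I" "\<And>j. j \<in> insert i I \<Longrightarrow> F j \<in> carrier_mat nr nc"
  shows "mat_sum nr nc F (insert i I) = F i + mat_sum nr nc F I"
  using abelian_monoid.finsum_insert[OF abelian_monoid_module_mat[where 'a=real], of I i F nr nc] assms
  by (auto simp: module_mat_simps)

lemma transpose_mat_sum:
  assumes "finite I" "\<And>i. i \<in> I \<Longrightarrow> F i \<in> carrier_mat nr nc"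
  shows "transpose_mat (mat_sum nr nc F I) = mat_sum nc nr (\<lambda>i. transpose_mat (F i)) I"
  using assms
proof (induction I rule: finite_induct)
  case empty
  show ?case by (simp add: mat_sum_empty)
next
  case (insert i I)
  have "mat_sum nr nc F (insert i I) = F i + mat_sum nr nc F I"
    using insert by (intro mat_sum_insert) auto
  moreover have "F i \<in> carrier_mat nr nc" "mat_sum nr nc F I \<in> carrier_mat nr nc"
    using insert.prems by (auto intro: mat_sum_carrier)
  ultimately have "transpose_mat (mat_sum nr nc F (insert i I))
      = transpose_mat (F i) + transpose_mat (mat_sum nr nc F I)"
    by (simp add: transpose_add)
  also have "\<dots> = mat_sum nc nr (\<lambda>i. transpose_mat (F i)) (insert i I)"
    using insert by (subst mat_sum_insert) auto
  finally show ?case .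
qed

section \<open>Kronecker products acting on vectorized matrices\<close>

text \<open>The number of rows is written \<open>m' * n'\<close>, the length of a vectorized \<open>m' \<times> n'\<close> matrix,
  although \<open>n' * m'\<close> would match the order of the factors of the Kronecker product.\<close>

lemma kronecker_carrier [simp]:
  assumes "K \<in> carrier_mat n' n" "H \<in> carrier_mat m' m"
  shows "kronecker K H \<in> carrier_mat (m' * n') (m * n)"
  using assms by (auto simp: kronecker_def mult.commute)

lemma transpose_kronecker:
  "transpose_mat (kronecker K H) = kronecker (transpose_mat K) (transpose_mat H)"
proof (rule eq_matI)
  fix r c
  assume "r < dim_row (kronecker (transpose_mat K) (transpose_mat H))"
    and "c < dim_col (kronecker (transpose_mat K) (transpose_mat H))"
  then have "r < dim_col H * dim_col K" "c < dim_row H * dim_row K"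
    by (simp_all add: kronecker_def mult.commute)
  moreover from this have "r mod dim_col H < dim_col H" "r div dim_col H < dim_col K"
      "c mod dim_row H < dim_row H" "c div dim_row H < dim_row K"
    by (blast intro: row_index_less column_index_less)+
  ultimately show "transpose_mat (kronecker K H) $$ (r, c)
      = kronecker (transpose_mat K) (transpose_mat H) $$ (r, c)"
    by (simp add: kronecker_def mult.commute)
qed (simp_all add: kronecker_def)

text \<open>Every index below \<open>m * n\<close> is \<open>j * m + q\<close> for exactly one \<open>j < n\<close> and \<open>q < m\<close>: a sum
  over a vectorized matrix becomes a double sum over its columns and rows.\<close>

lemma sum_blocks:
  fixes f :: "nat \<Rightarrow> 'a::comm_monoid_add"
  shows "(\<Sum>c<m * n. f c) = (\<Sum>j<n. \<Sum>q<m. f (j * m + q))"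
proof -
  have "(\<Sum>q<m. f (j * m + q)) = sum f {j * m..<j * m + m}" for j
    using sum.shift_bounds_nat_ivl[of f 0 "j * m" m]
    by (simp add: atLeast0LessThan add.commute)
  then show ?thesis
    using sum.nat_group[of f m n] by (simp add: mult.commute)
qed

text \<open>Both sides have, at the index belonging to row \<open>p\<close> and column \<open>i\<close>, the entry
  \<open>\<Sum>j q. K\<^sub>i\<^sub>j * H\<^sub>p\<^sub>q * X\<^sub>q\<^sub>j\<close>. The transpose of \<open>K\<close> appears because \<open>K\<close> acts on the column
  index of \<open>X\<close>.\<close>

lemma kronecker_mult_vectorize:
  fixes X :: "'a::comm_ring_1 mat"
  assumes K: "K \<in> carrier_mat n' n" and H: "H \<in> carrier_mat m' m" and X: "X \<in> carrier_mat m n"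
  shows "kronecker K H *\<^sub>v vectorize X = vectorize (H * X * transpose_mat K)"
proof (rule eq_vecI)
  show "dim_vec (kronecker K H *\<^sub>v vectorize X) = dim_vec (vectorize (H * X * transpose_mat K))"
    using K H by (simp add: kronecker_def vectorize_def mult.commute)
next
  fix r
  assume "r < dim_vec (vectorize (H * X * transpose_mat K))"
  then have r: "r < m' * n'" using K H by (simp add: vectorize_def)
  define i p where "i = r div m'" and "p = r mod m'"
  have i: "i < n'" and p: "p < m'"
    using r by (simp_all add: i_def p_def row_index_less column_index_less)
  have r_eq: "r = i * m' + p" by (simp add: i_def p_def)
  have "(kronecker K H *\<^sub>v vectorize X) $ r
      = (\<Sum>c<m * n. kronecker K H $$ (r, c) * vectorize X $ c)"
    using kronecker_carrier[OF K H] vectorize_carrier[OF X] r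
    by (auto simp: scalar_prod_def atLeast0LessThan intro!: sum.cong)
  also have "\<dots> = (\<Sum>j<n. \<Sum>q<m.
      kronecker K H $$ (i * m' + p, j * m + q) * vectorize X $ (j * m + q))"
    by (simp add: sum_blocks r_eq)
  also have "\<dots> = (\<Sum>j<n. \<Sum>q<m. K $$ (i, j) * H $$ (p, q) * X $$ (q, j))"
    using i p by (intro sum.cong refl)
      (simp add: kronecker_index[OF K H] vectorize_index[OF X])
  also have "\<dots> = (\<Sum>j<n. (\<Sum>q<m. H $$ (p, q) * X $$ (q, j)) * K $$ (i, j))"
    by (simp add: sum_distrib_left sum_distrib_right mult.commute mult.left_commute)
  also have "\<dots> = (H * X * transpose_mat K) $$ (p, i)"
    using K H X i p by (simp add: scalar_prod_def atLeast0LessThan del: assoc_mult_mat)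
  also have "\<dots> = vectorize (H * X * transpose_mat K) $ r"
    using K H X i p unfolding r_eq
    by (subst vectorize_index[of _ m' n']) auto
  finally show "(kronecker K H *\<^sub>v vectorize X) $ r = vectorize (H * X * transpose_mat K) $ r" .
qed

lemma kronecker_sum_mult_vectorize:
  fixes X :: "real mat"
  assumes "finite I" and "\<And>i. i \<in> I \<Longrightarrow> K i \<in> carrier_mat n' n"
    and "\<And>i. i \<in> I \<Longrightarrow> H i \<in> carrier_mat m' m" and X: "X \<in> carrier_mat m n"
  shows "mat_sum (m' * n') (m * n) (\<lambda>i. kronecker (K i) (H i)) I *\<^sub>v vectorize X
    = vectorize (mat_sum m' n' (\<lambda>i. H i * X * transpose_mat (K i)) I)"
  using assms(1-3)
proof (induction I rule: finite_induct)
  case empty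
  have "0\<^sub>m (m' * n') (m * n) *\<^sub>v vectorize X = vectorize (0\<^sub>m m' n')"
    using vectorize_carrier[OF X]
    by (auto simp: vectorize_def scalar_prod_def row_index_less column_index_less)
  then show ?case by (simp add: mat_sum_empty)
next
  case (insert i I)
  have K: "K j \<in> carrier_mat n' n" and H: "H j \<in> carrier_mat m' m" if "j \<in> insert i I" for j
    using that insert.prems by auto
  have term_carrier: "H j * X * transpose_mat (K j) \<in> carrier_mat m' n'" if "j \<in> insert i I" for j
    using K[OF that] H[OF that] X by auto
  have kron_carrier: "kronecker (K j) (H j) \<in> carrier_mat (m' * n') (m * n)"
    if "j \<in> insert i I" for j
    using K[OF that] H[OF that] by simp
  have sum_carrier:
    "mat_sum (m' * n') (m * n) (\<lambda>i. kronecker (K i) (H i)) I \<in> carrier_mat (m' * n') (m * n)"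
    "mat_sum m' n' (\<lambda>i. H i * X * transpose_mat (K i)) I \<in> carrier_mat m' n'"
    using kron_carrier term_carrier by (auto intro!: mat_sum_carrier)
  have "mat_sum (m' * n') (m * n) (\<lambda>i. kronecker (K i) (H i)) (insert i I) *\<^sub>v vectorize X
      = kronecker (K i) (H i) *\<^sub>v vectorize X
        + mat_sum (m' * n') (m * n) (\<lambda>i. kronecker (K i) (H i)) I *\<^sub>v vectorize X"
    using insert.hyps kron_carrier sum_carrier X
    by (subst mat_sum_insert) (auto intro!: add_mult_distrib_mat_vec[of _ "m' * n'" "m * n"])
  also have "\<dots> = vectorize (H i * X * transpose_mat (K i))
        + vectorize (mat_sum m' n' (\<lambda>i. H i * X * transpose_mat (K i)) I)"
    using insert.IH K H kronecker_mult_vectorize[of "K i" n' n "H i" m' m X] X by simp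
  also have "\<dots> = vectorize (mat_sum m' n' (\<lambda>i. H i * X * transpose_mat (K i)) (insert i I))"
    using insert.hyps term_carrier sum_carrier
    by (subst mat_sum_insert) (auto intro!: vectorize_add[symmetric])
  finally show ?case .
qed

text \<open>The gradient of the least-squares term needs this adjoint. Transposing all the factors
  reduces it to the preceding lemma with the dimensions exchanged.\<close>

lemma transpose_kronecker_sum_mult_vectorize:
  fixes X :: "real mat"
  assumes "finite I" and K: "\<And>i. i \<in> I \<Longrightarrow> K i \<in> carrier_mat n' n"
    and H: "\<And>i. i \<in> I \<Longrightarrow> H i \<in> carrier_mat m' m" and X: "X \<in> carrier_mat m' n'"
  shows "transpose_mat (mat_sum (m' * n') (m * n) (\<lambda>i. kronecker (K i) (H i)) I) *\<^sub>v vectorize X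
    = vectorize (mat_sum m n (\<lambda>i. transpose_mat (H i) * X * K i) I)"
proof -
  have "transpose_mat (mat_sum (m' * n') (m * n) (\<lambda>i. kronecker (K i) (H i)) I)
      = mat_sum (m * n) (m' * n')
          (\<lambda>i. kronecker (transpose_mat (K i)) (transpose_mat (H i))) I"
    using assms by (simp add: transpose_mat_sum transpose_kronecker)
  then show ?thesis
    using kronecker_sum_mult_vectorize[of I "\<lambda>i. transpose_mat (K i)" n n'
        "\<lambda>i. transpose_mat (H i)" m m' X] assms
    by simp
qed

section \<open>The iterations correspond\<close>

text \<open>In the proof, \<open>R\<close> is the residual \<open>\<Sum>i. H\<^sub>i * W * K\<^sub>i\<^sup>T - B\<close> and \<open>G\<close> the gradient of the
  least-squares term at \<open>W\<close>; each vectorizes to its counterpart for the matrix \<open>A\<close>.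
  The update itself is the hypothesis \<open>Z\<close>, so that it can be discharged by the defining
  equation of the iteration.\<close>

lemma vectorize_gradient_step:
  fixes W B :: "real mat"
  assumes "finite I" and K: "\<And>i. i \<in> I \<Longrightarrow> K i \<in> carrier_mat n' n"
    and H: "\<And>i. i \<in> I \<Longrightarrow> H i \<in> carrier_mat m' m"
    and W: "W \<in> carrier_mat m n" and B: "B \<in> carrier_mat m' n'"
    and A: "A = mat_sum (m' * n') (m * n) (\<lambda>i. kronecker (K i) (H i)) I"
    and Z: "Z = c \<cdot>\<^sub>m (L \<cdot>\<^sub>m W - mat_sum m n (\<lambda>j. transpose_mat (H j) *
      (mat_sum m' n' (\<lambda>i. H i * W * transpose_mat (K i)) I - B) * K j) I)"
  shows "Z \<in> carrier_mat m n"
    and "vectorize Z = c \<cdot>\<^sub>v (L \<cdot>\<^sub>v vectorize W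
      - transpose_mat A *\<^sub>v (A *\<^sub>v vectorize W - vectorize B))"
proof -
  define R where "R = mat_sum m' n' (\<lambda>i. H i * W * transpose_mat (K i)) I - B"
  define G where "G = mat_sum m n (\<lambda>j. transpose_mat (H j) * R * K j) I"
  have sum_carrier: "mat_sum m' n' (\<lambda>i. H i * W * transpose_mat (K i)) I \<in> carrier_mat m' n'"
    using K H W by (intro mat_sum_carrier mult_carrier_mat) auto
  have R: "R \<in> carrier_mat m' n'"
    unfolding R_def using B by auto
  have G: "G \<in> carrier_mat m n"
    unfolding G_def using K H R by (intro mat_sum_carrier mult_carrier_mat) auto
  have Z_eq: "Z = c \<cdot>\<^sub>m (L \<cdot>\<^sub>m W - G)"
    by (simp add: Z G_def R_def)
  show "Z \<in> carrier_mat m n"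
    unfolding Z_eq using W G by auto
  have residual: "vectorize R = A *\<^sub>v vectorize W - vectorize B"
    using vectorize_minus[OF sum_carrier B] kronecker_sum_mult_vectorize[OF assms(1-4)]
    by (simp add: R_def A)
  have "vectorize G = transpose_mat A *\<^sub>v vectorize R"
    using transpose_kronecker_sum_mult_vectorize[OF assms(1-3) R] by (simp add: G_def A)
  with residual show "vectorize Z = c \<cdot>\<^sub>v (L \<cdot>\<^sub>v vectorize W
      - transpose_mat A *\<^sub>v (A *\<^sub>v vectorize W - vectorize B))"
    unfolding Z_eq using W G by (simp add: vectorize_smult vectorize_minus[of _ m n])
qed

theorem theorem3p2:
  fixes m n s N :: nat
    and K H :: "nat \<Rightarrow> real mat"
    and A\<^sub>s B X0 :: "real mat"
    and b x0 :: "real vec"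
    and lam L :: real
    and X Y :: "nat \<Rightarrow> real mat"
    and x y :: "nat \<Rightarrow> real vec"
  assumes "m \<ge> 1" and "n \<ge> 1" and "s \<ge> 1" and "N = m * n"
    and "\<And>i. i \<in> {1..s} \<Longrightarrow> K i \<in> carrier_mat n n"
    and "\<And>i. i \<in> {1..s} \<Longrightarrow> H i \<in> carrier_mat m m"
    and "A\<^sub>s = mat_sum N N (\<lambda>i. kronecker (K i) (H i)) {1..s}"
    and "B \<in> carrier_mat m n" and "b = vectorize B"
    and "lam > 0"
    and "L > 0" and "gradient_lipschitz N (\<lambda>v. 1 / 2 * (norm2 (A\<^sub>s *\<^sub>v v - b))\<^sup>2) L"
    and "X0 \<in> carrier_mat m n" and "sFISTA m n s K H B lam L X0 X Y"
    and "x0 \<in> carrier_vec N" and "FISTA A\<^sub>s b lam L x0 x y"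
    and "x0 = vectorize X0"
  shows "\<forall>k\<ge>1. x k = vectorize (X k) \<and> y k = vectorize (Y k)"
proof -
  note K = assms(5) and H = assms(6) and N = assms(4) and A = assms(7) and B = assms(8)
    and b = assms(9) and matrix_run = assms(14)[unfolded sFISTA_def]
    and vector_run = assms(16)[unfolded FISTA_def]
  have gradient_step: "X k \<in> carrier_mat m n \<and> x k = vectorize (X k)"
    if k: "k \<ge> 1" and Y: "Y k \<in> carrier_mat m n" "y k = vectorize (Y k)" for k
  proof -
    have X_k: "X k = (1 / (L + lam\<^sup>2)) \<cdot>\<^sub>m (L \<cdot>\<^sub>m Y k -
        mat_sum m n (\<lambda>j. transpose_mat (H j) *
          (mat_sum m n (\<lambda>i. H i * Y k * transpose_mat (K i)) {1..s} - B) * K j) {1..s})"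
      and x_k: "x k = (1 / (L + lam\<^sup>2)) \<cdot>\<^sub>v
        (L \<cdot>\<^sub>v y k - transpose_mat A\<^sub>s *\<^sub>v (A\<^sub>s *\<^sub>v y k - b))"
      using matrix_run vector_run k by blast+
    show ?thesis
      using vectorize_gradient_step[OF _ K H Y(1) B A[unfolded N] X_k] x_k Y(2) b by simp
  qed
  have momentum_step: "Y (k + 1) \<in> carrier_mat m n \<and> y (k + 1) = vectorize (Y (k + 1))"
    if k: "k \<ge> 1" and X: "X k \<in> carrier_mat m n" "x k = vectorize (X k)"
      and X': "X (k - 1) \<in> carrier_mat m n" "x (k - 1) = vectorize (X (k - 1))" for k
  proof -
    have "Y (k + 1) = X k + ((fista_t k - 1) / fista_t (k + 1)) \<cdot>\<^sub>m (X k - X (k - 1))"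
      and "y (k + 1) = x k + ((fista_t k - 1) / fista_t (k + 1)) \<cdot>\<^sub>v (x k - x (k - 1))"
      using matrix_run vector_run k by blast+
    moreover have "X k - X (k - 1) \<in> carrier_mat m n"
      using X X' by auto
    ultimately show ?thesis
      using X X' by (simp add: vectorize_add[of _ m n] vectorize_smult vectorize_minus[of _ m n])
  qed
  have "X (k - 1) \<in> carrier_mat m n \<and> x (k - 1) = vectorize (X (k - 1)) \<and>
      Y k \<in> carrier_mat m n \<and> y k = vectorize (Y k)" if "k \<ge> 1" for k
    using that
  proof (induction k rule: dec_induct)
    case base
    show ?case using matrix_run vector_run assms(13,17) by simp
  next
    case (step k)
    then show ?case using gradient_step[of k] momentum_step[of k] by simp
  qed
  then show ?thesis using gradient_step by blast
qed

end
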